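(* Let $G$ be a real Lie group of dimension $n\ge 3$ with Lie algebra $\mathfrak g$ whose derived algebra $\mathfrak g'=[\mathfrak g,\mathfrak g]$ is two-dimensional, and let $(J,g)$ be a left-invariant Hermitian structure on $G$ of Type I, i.e. $J(\mathfrak g')=\mathfrak g'$. Let $\{\mathsf e_1,\mathsf e_2\}$ be an orthonormal basis of $\mathfrak g'$ with $J\mathsf e_1=\mathsf e_2$, let $\Gamma=(\mathfrak g')^\perp$, and let $\mathsf a_1,\mathsf a_2,\mathsf b_1,\mathsf b_2\in\Gamma$ and $f_1,f_2:\Gamma\to\Gamma$ be the structure data of $\mathfrak g$ with respect to this basis (defined in the context). Then $(J,g)$ is Kähler if and only if $f_1=f_2=0$ and $\mathsf b_2=-\mathsf a_1$.
   Context: Left-invariant structures are identified with their values on $\mathfrak g$: $g$ corresponds to an inner product $\langle\cdot,\cdot\rangle$ on $\mathfrak g$, and $J$ to a linear map $J:\mathfrak g\to\mathfrak g$ with $J^2=-\mathrm{Id}$. The pair $(J,g)$ is Hermitian if $\langle Jx,Jy\rangle=\langle x,y\rangle$ for all $x,y\in\mathfrak g$ and $J$ is integrable, i.e. $N_J(x,y)=[x,y]+J([Jx,y]+[x,Jy])-[Jx,Jy]=0$ for all $x,y\in\mathfrak g$. It is Kähler if the 2-form $\omega(x,y)=\langle Jx,y\rangle$ is closed, i.e. $d\omega=0$; for left-invariant forms this means $\omega([x,y],z)+\omega([y,z],x)+\omega([z,x],y)=0$ for all $x,y,z\in\mathfrak g$. Structure data. If $\dim\mathfrak g'=2$ then $\mathfrak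 g$ is solvable and $\mathfrak g'$ is abelian. Let $\{\mathsf e_1,\mathsf e_2\}$ be an orthonormal basis of $\mathfrak g'$ and $\Gamma$ the orthogonal complement of $\mathfrak g'$ in $\mathfrak g$. There are unique vectors $\mathsf a_1,\mathsf a_2,\mathsf b_1,\mathsf b_2\in\Gamma$ and unique skew-adjoint linear maps $f_1,f_2:\Gamma\to\Gamma$ such that for all $u,v\in\Gamma$ $$[u,\mathsf e_1]=\langle\mathsf a_1,u\rangle\mathsf e_1+\langle\mathsf a_2,u\rangle\mathsf e_2,\qquad [u,\mathsf e_2]=\langle\mathsf b_1,u\rangle\mathsf e_1+\langle\mathsf b_2,u\rangle\mathsf e_2,$$ $$[u,v]=\langle f_1(u),v\rangle\mathsf e_1+\langle f_2(u),v\rangle\mathsf e_2.$$ *)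

theory Defs
  imports "HOL-Analysis.Analysis"
begin

text \<open>
  Left-invariant structures on a Lie group are identified with their values on the Lie algebra.
  The underlying inner product space of the Lie algebra is a type of class
  \<^class>\<open>euclidean_space\<close>, so the left-invariant metric is the inner product of that
  class; the bracket and the complex structure are explicit functions.
\<close>

definition lie_bracket :: "('a::real_vector \<Rightarrow> 'a \<Rightarrow> 'a) \<Rightarrow> bool" where
  "lie_bracket br \<longleftrightarrow>
     bilinear br \<and>
     (\<forall>x. br x x = 0) \<and>
     (\<forall>x y z. br x (br y z) + br y (br z x) + br z (br x y) = 0)"

definition derived_algebra :: "('a::real_vector \<Rightarrow> 'a \<Rightarrow> 'a) \<Rightarrow> 'a set" where
  "derived_algebra br = span {br x y | x y. True}"

definition complex_structure :: "('a::real_vector \<Rightarrow> 'a) \<Rightarrow> bool" where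
  "complex_structure J \<longleftrightarrow> linear J \<and> (\<forall>x. J (J x) = - x)"

definition nijenhuis :: "('a::real_vector \<Rightarrow> 'a \<Rightarrow> 'a) \<Rightarrow> ('a \<Rightarrow> 'a) \<Rightarrow> 'a \<Rightarrow> 'a \<Rightarrow> 'a" where
  "nijenhuis br J x y = br x y + J (br (J x) y + br x (J y)) - br (J x) (J y)"

definition hermitian_structure :: "('a::euclidean_space \<Rightarrow> 'a \<Rightarrow> 'a) \<Rightarrow> ('a \<Rightarrow> 'a) \<Rightarrow> bool" where
  "hermitian_structure br J \<longleftrightarrow>
     complex_structure J \<and>
     (\<forall>x y. J x \<bullet> J y = x \<bullet> y) \<and>
     (\<forall>x y. nijenhuis br J x y = 0)"

definition fundamental_form :: "('a::euclidean_space \<Rightarrow> 'a) \<Rightarrow> 'a \<Rightarrow> 'a \<Rightarrow> real" where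
  "fundamental_form J x y = J x \<bullet> y"

text \<open>On left-invariant vector fields a left-invariant 2-form takes constant values, so only the
  bracket terms of the exterior derivative survive.\<close>

definition closed_2form ::
  "('a::real_vector \<Rightarrow> 'a \<Rightarrow> 'a) \<Rightarrow> ('a \<Rightarrow> 'a \<Rightarrow> real) \<Rightarrow> bool" where
  "closed_2form br \<omega> \<longleftrightarrow> (\<forall>x y z. \<omega> (br x y) z + \<omega> (br y z) x + \<omega> (br z x) y = 0)"

definition kaehler_structure :: "('a::euclidean_space \<Rightarrow> 'a \<Rightarrow> 'a) \<Rightarrow> ('a \<Rightarrow> 'a) \<Rightarrow> bool" where
  "kaehler_structure br J \<longleftrightarrow>
     hermitian_structure br J \<and> closed_2form br (fundamental_form J)"

definition orthonormal_basis2 :: "'a::euclidean_space \<Rightarrow> 'a \<Rightarrow> 'a set \<Rightarrow> bool" where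
  "orthonormal_basis2 e1 e2 W \<longleftrightarrow>
     norm e1 = 1 \<and> norm e2 = 1 \<and> orthogonal e1 e2 \<and> span {e1, e2} = W"

text \<open>A linear map between subspaces is a function on the whole type of which only the
  values on the subspace matter.\<close>

definition skew_adjoint_on :: "'a::euclidean_space set \<Rightarrow> ('a \<Rightarrow> 'a) \<Rightarrow> bool" where
  "skew_adjoint_on W f \<longleftrightarrow>
     (\<forall>u\<in>W. f u \<in> W) \<and>
     (\<forall>u\<in>W. \<forall>v\<in>W. f (u + v) = f u + f v) \<and>
     (\<forall>c. \<forall>u\<in>W. f (c *\<^sub>R u) = c *\<^sub>R f u) \<and>
     (\<forall>u\<in>W. \<forall>v\<in>W. f u \<bullet> v = - (u \<bullet> f v))"

definition structure_data ::
  "('a::euclidean_space \<Rightarrow> 'a \<Rightarrow> 'a) \<Rightarrow> 'a \<Rightarrow> 'a \<Rightarrow> 'a \<Rightarrow> 'a \<Rightarrow> 'a \<Rightarrow> 'a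
     \<Rightarrow> ('a \<Rightarrow> 'a) \<Rightarrow> ('a \<Rightarrow> 'a) \<Rightarrow> bool" where
  "structure_data br e1 e2 a1 a2 b1 b2 f1 f2 \<longleftrightarrow>
     (let \<Gamma> = (derived_algebra br)\<^sup>\<bottom> in
       a1 \<in> \<Gamma> \<and> a2 \<in> \<Gamma> \<and> b1 \<in> \<Gamma> \<and> b2 \<in> \<Gamma> \<and>
       skew_adjoint_on \<Gamma> f1 \<and> skew_adjoint_on \<Gamma> f2 \<and>
       (\<forall>u\<in>\<Gamma>. br u e1 = (a1 \<bullet> u) *\<^sub>R e1 + (a2 \<bullet> u) *\<^sub>R e2) \<and>
       (\<forall>u\<in>\<Gamma>. br u e2 = (b1 \<bullet> u) *\<^sub>R e1 + (b2 \<bullet> u) *\<^sub>R e2) \<and>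
       (\<forall>u\<in>\<Gamma>. \<forall>v\<in>\<Gamma>. br u v = (f1 u \<bullet> v) *\<^sub>R e1 + (f2 u \<bullet> v) *\<^sub>R e2))"

end

theory Submission
  imports Defs
begin

text \<open>
  Since \<open>J\<close> preserves the derived algebra \<open>\<gg>'\<close> and is orthogonal,
  \<open>\<omega>(\<gg>', \<Gamma>) = 0\<close>. Hence \<open>d\<omega>\<close> vanishes on \<open>\<Gamma> \<times> \<Gamma> \<times> \<Gamma>\<close>, and
  \<open>d\<omega>(u,v,e1) = -\<langle>f2 u, v\<rangle>\<close>, \<open>d\<omega>(u,v,e2) = \<langle>f1 u, v\<rangle>\<close> and
  \<open>d\<omega>(e1,e2,u) = \<langle>a1 + b2, u\<rangle>\<close>; these are all the independent components of \<open>d\<omega>\<close>.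
  The bracket of \<open>e1\<close> and \<open>e2\<close> enters only through \<open>\<omega>([e1,e2],u) = 0\<close>.
\<close>

lemma lie_bracket_skew:
  assumes "lie_bracket br"
  shows "br y x = - br x y"
proof -
  have b: "bilinear br" and alt: "\<And>x. br x x = 0"
    using assms by (auto simp: lie_bracket_def)
  have "br y x + br x y = br (x + y) (x + y)"
    unfolding bilinear_ladd[OF b] bilinear_radd[OF b] by (simp add: alt)
  also have "\<dots> = 0"
    by (rule alt)
  finally show ?thesis
    by (simp add: eq_neg_iff_add_eq_0)
qed

lemma lie_bracket_in_derived_algebra: "br x y \<in> derived_algebra br"
  unfolding derived_algebra_def by (rule span_base) blast

lemma orthonormal_basis2_inner:
  assumes "orthonormal_basis2 e1 e2 W"
  shows "e1 \<bullet> e1 = 1" "e2 \<bullet> e2 = 1" "e1 \<bullet> e2 = 0" "e2 \<bullet> e1 = 0"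
  using assms
  by (simp_all add: orthonormal_basis2_def orthogonal_def norm_eq_1 inner_commute[of e2 e1])

text \<open>Turns membership in \<Gamma> into two scalar equations, a form usable for
  rewriting.\<close>

lemma orthonormal_basis2_comp_iff:
  assumes "orthonormal_basis2 e1 e2 W"
  shows "u \<in> W\<^sup>\<bottom> \<longleftrightarrow> u \<bullet> e1 = 0 \<and> u \<bullet> e2 = 0"
proof -
  have W: "W = span {e1, e2}"
    using assms by (simp add: orthonormal_basis2_def)
  show ?thesis
  proof
    assume "u \<in> W\<^sup>\<bottom>"
    then show "u \<bullet> e1 = 0 \<and> u \<bullet> e2 = 0"
      by (auto simp: W orthogonal_comp_def orthogonal_def span_base inner_commute)
  next
    assume u: "u \<bullet> e1 = 0 \<and> u \<bullet> e2 = 0"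
    have "orthogonal u w" if "w \<in> W" for w
      using u by (intro orthogonal_to_span[OF that[unfolded W]]) (auto simp: orthogonal_def)
    then show "u \<in> W\<^sup>\<bottom>"
      by (auto simp: orthogonal_comp_def orthogonal_commute)
  qed
qed

lemma orthonormal_basis2_expansion:
  assumes "orthonormal_basis2 e1 e2 W" and "w \<in> W"
  shows "w = (w \<bullet> e1) *\<^sub>R e1 + (w \<bullet> e2) *\<^sub>R e2"
proof -
  have "w \<in> span {e1, e2}"
    using assms by (simp add: orthonormal_basis2_def)
  then obtain s t where "w = s *\<^sub>R e1 + t *\<^sub>R e2"
    by (auto simp: span_insert span_singleton algebra_simps)
  then show ?thesis
    by (simp add: inner_add_left orthonormal_basis2_inner[OF assms(1)])
qed

text \<open>Keeps the coordinates as inner products, so that they match those in the formula for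
  \<omega> on brackets.\<close>

lemma orthonormal_basis2_decompose:
  fixes x :: "'a::euclidean_space"
  assumes "orthonormal_basis2 e1 e2 W"
  obtains u where "u \<in> W\<^sup>\<bottom>" "x = (x \<bullet> e1) *\<^sub>R e1 + (x \<bullet> e2) *\<^sub>R e2 + u"
proof
  show "x - (x \<bullet> e1) *\<^sub>R e1 - (x \<bullet> e2) *\<^sub>R e2 \<in> W\<^sup>\<bottom>"
    by (simp add: orthonormal_basis2_comp_iff[OF assms] orthonormal_basis2_inner[OF assms]
        inner_diff_left)
qed simp

text \<open>\<open>P\<close> and \<open>Q\<close> are the \<open>e1\<close>- and \<open>e2\<close>-coordinates of a bracket when
  \<open>f1 = f2 = 0\<close> and \<open>b2 = -a1\<close>, with \<open>(c1, c2)\<close> those of \<open>[e1, e2]\<close> and \<open>u1, u2, u3\<close> the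
  values of \<open>a1, a2, b1\<close> on the \<open>\<Gamma>\<close>-component.\<close>

lemma cyclic_sum_zero:
  fixes x y z x' y' z' u1 u2 u3 v1 v2 v3 w1 w2 w3 c1 c2 :: real
  defines "P \<equiv> \<lambda>x x' u1 u3 y y' v1 v3. (x * y' - x' * y) * c1 + (y * u1 + y' * u3 - x * v1 - x' * v3)"
    and "Q \<equiv> \<lambda>x x' u1 u2 y y' v1 v2. (x * y' - x' * y) * c2 + (y * u2 - y' * u1 - x * v2 + x' * v1)"
  shows "(P x x' u1 u3 y y' v1 v3 * z' - Q x x' u1 u2 y y' v1 v2 * z)
       + (P y y' v1 v3 z z' w1 w3 * x' - Q y y' v1 v2 z z' w1 w2 * x)
       + (P z z' w1 w3 x x' u1 u3 * y' - Q z z' w1 w2 x x' u1 u2 * y) = 0"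
  unfolding P_def Q_def by algebra

theorem theorem3p1:
  fixes br :: "'a::euclidean_space \<Rightarrow> 'a \<Rightarrow> 'a"
    and J f1 f2 :: "'a \<Rightarrow> 'a"
    and e1 e2 a1 a2 b1 b2 :: 'a
  assumes "lie_bracket br"
    and "DIM('a) \<ge> 3"
    and "dim (derived_algebra br) = 2"
    and "hermitian_structure br J"
    and "J ` derived_algebra br = derived_algebra br"
    and "orthonormal_basis2 e1 e2 (derived_algebra br)"
    and "J e1 = e2"
    and "structure_data br e1 e2 a1 a2 b1 b2 f1 f2"
  shows "kaehler_structure br J \<longleftrightarrow>
    (\<forall>u\<in>(derived_algebra br)\<^sup>\<bottom>. f1 u = 0) \<and>
    (\<forall>u\<in>(derived_algebra br)\<^sup>\<bottom>. f2 u = 0) \<and>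
    b2 = - a1"
proof -
  let ?W = "derived_algebra br"
  note ob = assms(6)
  note inn = orthonormal_basis2_inner[OF ob]
  note perp = orthonormal_basis2_comp_iff[OF ob]
  note skew = lie_bracket_skew[OF assms(1)]
  have bil: "bilinear br" and alt: "\<And>x. br x x = 0"
    using assms(1) by (auto simp: lie_bracket_def)
  have lin: "linear J" and J2: "\<And>x. J (J x) = - x"
    using assms(4) by (auto simp: hermitian_structure_def complex_structure_def)
  have Je2: "J e2 = - e1"
    using J2[of e1] assms(7) by simp
  define \<omega> where "\<omega> = fundamental_form J"
  have \<omega>: "\<omega> (p *\<^sub>R e1 + q *\<^sub>R e2) z = p * (z \<bullet> e2) - q * (z \<bullet> e1)" for p q z
    by (simp add: \<omega>_def fundamental_form_def linear_add[OF lin] linear_scale[OF lin]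
        assms(7) Je2 inner_diff_left inner_commute[of z e1] inner_commute[of z e2])
  \<comment> \<open>Brackets lie in \<gg>', which \<open>J\<close> preserves, so the \<Gamma>-part
    of \<open>z\<close> drops out and d\<omega> becomes scalar arithmetic in \<open>e1\<close>,
    \<open>e2\<close> coordinates.\<close>
  have \<omega>_br: "\<omega> (br x y) z = (br x y \<bullet> e1) * (z \<bullet> e2) - (br x y \<bullet> e2) * (z \<bullet> e1)" for x y z
    by (subst orthonormal_basis2_expansion[OF ob lie_bracket_in_derived_algebra]) (rule \<omega>)
  have a1: "a1 \<in> ?W\<^sup>\<bottom>" and b2: "b2 \<in> ?W\<^sup>\<bottom>"
    and sk: "skew_adjoint_on (?W\<^sup>\<bottom>) f1" "skew_adjoint_on (?W\<^sup>\<bottom>) f2"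
    and br1: "\<And>u. u \<in> ?W\<^sup>\<bottom> \<Longrightarrow> br u e1 = (a1 \<bullet> u) *\<^sub>R e1 + (a2 \<bullet> u) *\<^sub>R e2"
    and br2: "\<And>u. u \<in> ?W\<^sup>\<bottom> \<Longrightarrow> br u e2 = (b1 \<bullet> u) *\<^sub>R e1 + (b2 \<bullet> u) *\<^sub>R e2"
    and brf: "\<And>u v. u \<in> ?W\<^sup>\<bottom> \<Longrightarrow> v \<in> ?W\<^sup>\<bottom> \<Longrightarrow>
      br u v = (f1 u \<bullet> v) *\<^sub>R e1 + (f2 u \<bullet> v) *\<^sub>R e2"
    using assms(8) unfolding structure_data_def Let_def by blast+
  have f1: "f1 u \<in> ?W\<^sup>\<bottom>" and f2: "f2 u \<in> ?W\<^sup>\<bottom>" if "u \<in> ?W\<^sup>\<bottom>" for u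
    using sk that by (auto simp: skew_adjoint_on_def)
  note coords = inn inner_add_left
  have "kaehler_structure br J \<longleftrightarrow> (\<forall>x y z. \<omega> (br x y) z + \<omega> (br y z) x + \<omega> (br z x) y = 0)"
    using assms(4) by (simp add: kaehler_structure_def closed_2form_def \<omega>_def)
  also have "\<dots> \<longleftrightarrow> (\<forall>u\<in>?W\<^sup>\<bottom>. f1 u = 0) \<and> (\<forall>u\<in>?W\<^sup>\<bottom>. f2 u = 0) \<and> b2 = - a1"
  proof (intro iffI conjI ballI)
    assume "\<forall>x y z. \<omega> (br x y) z + \<omega> (br y z) x + \<omega> (br z x) y = 0"
    then have closed: "\<omega> (br x y) z + \<omega> (br y z) x + \<omega> (br z x) y = 0" for x y z
      by blast
    \<comment> \<open>Testing on \<open>f1 u\<close> itself, which lies in \<Gamma>, makes this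
      component of d\<omega> equal to the squared norm of \<open>f1 u\<close>; the sum for
      \<open>f2\<close> is minus a squared norm.\<close>
    show "f1 u = 0" if u: "u \<in> ?W\<^sup>\<bottom>" for u
      using closed[of u "f1 u" e2] u f1[OF u] by (simp add: \<omega>_br brf coords perp)
    show "f2 u = 0" if u: "u \<in> ?W\<^sup>\<bottom>" for u
      using closed[of u "f2 u" e1] u f2[OF u] by (simp add: \<omega>_br brf coords perp)
    have ab: "a1 + b2 \<in> ?W\<^sup>\<bottom>"
      using a1 b2 by (simp add: perp inner_add_left)
    \<comment> \<open>For \<open>u\<close> in \<Gamma> the trace of ad \<open>u\<close> on \<gg>' is
      the inner product of \<open>a1 + b2\<close> with \<open>u\<close>; it is evaluated here at
      \<open>u = a1 + b2\<close>.\<close>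
    have "(a1 + b2) \<bullet> (a1 + b2) = 0"
      using closed[of e1 e2 "a1 + b2", unfolded \<omega>_br] ab skew[of e2 "a1 + b2"]
      by (simp add: br1 br2 coords perp)
    then show "b2 = - a1"
      by (simp add: add_eq_0_iff)
  next
    assume R: "(\<forall>u\<in>?W\<^sup>\<bottom>. f1 u = 0) \<and> (\<forall>u\<in>?W\<^sup>\<bottom>. f2 u = 0) \<and> b2 = - a1"
    have br0: "br u v = 0" if "u \<in> ?W\<^sup>\<bottom>" "v \<in> ?W\<^sup>\<bottom>" for u v
      using R that by (simp add: brf)
    \<comment> \<open>Left as an unknown vector: its coordinates enter the cyclic sum multiplied by
      3 by 3 determinants with a repeated row.\<close>
    define c where "c = br e1 e2"
    have expand: "br (x *\<^sub>R e1 + x' *\<^sub>R e2 + u) (y *\<^sub>R e1 + y' *\<^sub>R e2 + v)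
        = (x * y' - x' * y) *\<^sub>R c + y *\<^sub>R br u e1 + y' *\<^sub>R br u e2 - x *\<^sub>R br v e1 - x' *\<^sub>R br v e2"
      if "u \<in> ?W\<^sup>\<bottom>" "v \<in> ?W\<^sup>\<bottom>" for x x' y y' u v
      using that
      by (simp add: bilinear_ladd[OF bil] bilinear_radd[OF bil] bilinear_lmul[OF bil]
          bilinear_rmul[OF bil] alt br0 skew[of e2 e1] skew[of e1 v] skew[of e2 v] c_def
          algebra_simps)
    show "\<forall>x y z. \<omega> (br x y) z + \<omega> (br y z) x + \<omega> (br z x) y = 0"
    proof (intro allI)
      fix x y z
      obtain u where u: "u \<in> ?W\<^sup>\<bottom>" and x: "x = (x \<bullet> e1) *\<^sub>R e1 + (x \<bullet> e2) *\<^sub>R e2 + u"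
        by (rule orthonormal_basis2_decompose[OF ob])
      obtain v where v: "v \<in> ?W\<^sup>\<bottom>" and y: "y = (y \<bullet> e1) *\<^sub>R e1 + (y \<bullet> e2) *\<^sub>R e2 + v"
        by (rule orthonormal_basis2_decompose[OF ob])
      obtain w where w: "w \<in> ?W\<^sup>\<bottom>" and z: "z = (z \<bullet> e1) *\<^sub>R e1 + (z \<bullet> e2) *\<^sub>R e2 + w"
        by (rule orthonormal_basis2_decompose[OF ob])
      have e: "br x y \<bullet> e1 = (x \<bullet> e1 * (y \<bullet> e2) - x \<bullet> e2 * (y \<bullet> e1)) * (c \<bullet> e1) +
            (y \<bullet> e1 * (a1 \<bullet> u) + y \<bullet> e2 * (b1 \<bullet> u) - x \<bullet> e1 * (a1 \<bullet> v) - x \<bullet> e2 * (b1 \<bullet> v))" (is ?p)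
          "br x y \<bullet> e2 = (x \<bullet> e1 * (y \<bullet> e2) - x \<bullet> e2 * (y \<bullet> e1)) * (c \<bullet> e2) +
            (y \<bullet> e1 * (a2 \<bullet> u) - y \<bullet> e2 * (a1 \<bullet> u) - x \<bullet> e1 * (a2 \<bullet> v) + x \<bullet> e2 * (a1 \<bullet> v))" (is ?q)
        if "u \<in> ?W\<^sup>\<bottom>" "v \<in> ?W\<^sup>\<bottom>"
          "x = (x \<bullet> e1) *\<^sub>R e1 + (x \<bullet> e2) *\<^sub>R e2 + u"
          "y = (y \<bullet> e1) *\<^sub>R e1 + (y \<bullet> e2) *\<^sub>R e2 + v" for x y u v
      proof -
        have "br x y = (x \<bullet> e1 * (y \<bullet> e2) - x \<bullet> e2 * (y \<bullet> e1)) *\<^sub>R c + (y \<bullet> e1) *\<^sub>R br u e1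
            + (y \<bullet> e2) *\<^sub>R br u e2 - (x \<bullet> e1) *\<^sub>R br v e1 - (x \<bullet> e2) *\<^sub>R br v e2"
          \<comment> \<open>The decompositions have \<open>x\<close> and \<open>y\<close> on both
            sides and would loop as rewrite rules, so each is applied once by congruence.\<close>
          by (rule trans[OF arg_cong2[where f = br, OF that(3,4)] expand[OF that(1,2)]])
        then show ?p ?q
          using that(1,2) R by (simp_all add: br1 br2 coords inner_diff_left)
      qed
      \<comment> \<open>Since \<open>b2 = - a1\<close>, ad \<open>u\<close> is traceless on the
        plane \<gg>' and so infinitesimally preserves its area form \<omega>. This is why the terms
        in \<open>u\<close> cancel between the first and third summands, and likewise those in
        \<open>v\<close> and \<open>w\<close>.\<close>
      show "\<omega> (br x y) z + \<omega> (br y z) x + \<omega> (br z x) y = 0"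
        unfolding \<omega>_br e[OF u v x y] e[OF v w y z] e[OF w u z x]
        by (rule cyclic_sum_zero)
    qed
  qed
  finally show ?thesis .
qed

end
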